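(* Let $\alpha D$ be the one-point compactification of an uncountable discrete space $D$. Then $\alpha D$ is $CT_1$, $T_2$ and compact but not $CT_2$.
   Context: For a $T_1$-space $X$, $\mathrm{Cld}(X)$ denotes the set of all non-empty closed subsets of $X$, endowed with the Vietoris topology, i.e. the topology having as a subbase all sets $U^-=\{F\in\mathrm{Cld}(X): F\cap U\neq\emptyset\}$ and $U^+=\{F\in\mathrm{Cld}(X): F\subseteq U\}$ with $U$ open in $X$. Let $\triangle(X)=\{(x,x):x\in X\}$, and give $X^2\setminus\triangle(X)$ the subspace topology from $X^2$. $X$ is called $CT_1$ if there is a continuous map $\phi=(\phi_1,\phi_2):X^2\setminus\triangle(X)\to\mathrm{Cld}(X)^2$ such that for all $x_1\neq x_2$ in $X$: $x_1\notin\phi_1(x_1,x_2)$, $x_2\notin\phi_2(x_1,x_2)$, $x_1\in\phi_2(x_1,x_2)$ and $x_2\in\phi_1(x_1,x_2)$. $X$ is called $CT_2$ if there is a continuous map $\phi=(\phi_1,\phi_2):X^2\setminus\triangle(X)\to\mathrm{Cld}(X)^2$ such that for all $x_1\neq x_2$ in $X$: $\phi_1(x_1,x_2)\cup\phi_2(x_1,x_2)=X$, $x_1\notin\phi_1(x_1,x_2)$ and $x_2\notin\phi_2(x_1,x_2)$. *)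

theory Defs
  imports "HOL-Analysis.Analysis"
begin

definition Cld :: "'a topology \<Rightarrow> 'a set set" where
  "Cld X = {F. closedin X F \<and> F \<noteq> {}}"

definition vietoris :: "'a topology \<Rightarrow> 'a set topology" where
  "vietoris X = topology_generated_by
     ({{F \<in> Cld X. F \<inter> U \<noteq> {}} | U. openin X U} \<union>
      {{F \<in> Cld X. F \<subseteq> U} | U. openin X U})"

lemma topspace_vietoris [simp]: "topspace (vietoris X) = Cld X"
proof
  show "topspace (vietoris X) \<subseteq> Cld X"
    unfolding vietoris_def topology_generated_by_topspace by blast
  show "Cld X \<subseteq> topspace (vietoris X)"
  proof
    fix F assume F: "F \<in> Cld X"
    then have "F \<subseteq> topspace X"
      by (simp add: Cld_def closedin_subset)
    with F have "F \<in> {F \<in> Cld X. F \<subseteq> topspace X}"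
      by simp
    then show "F \<in> topspace (vietoris X)"
      unfolding vietoris_def topology_generated_by_topspace
      using openin_topspace by blast
  qed
qed

definition off_diagonal :: "'a topology \<Rightarrow> ('a \<times> 'a) topology" where
  "off_diagonal X = subtopology (prod_topology X X)
     (topspace X \<times> topspace X - {(x, x) | x. x \<in> topspace X})"

text \<open>The two notions below are intended for \<open>T\<^sub>1\<close>-spaces, but the defining
  conditions make sense for every topology, so separation is not built in.\<close>

definition CT1_space :: "'a topology \<Rightarrow> bool" where
  "CT1_space X \<longleftrightarrow>
     (\<exists>\<phi>1 \<phi>2.
        continuous_map (off_diagonal X) (prod_topology (vietoris X) (vietoris X))
          (\<lambda>p. (\<phi>1 p, \<phi>2 p)) \<and>
        (\<forall>x1 \<in> topspace X. \<forall>x2 \<in> topspace X. x1 \<noteq> x2 \<longrightarrow>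
           x1 \<notin> \<phi>1 (x1, x2) \<and> x2 \<notin> \<phi>2 (x1, x2) \<and>
           x1 \<in> \<phi>2 (x1, x2) \<and> x2 \<in> \<phi>1 (x1, x2)))"

definition CT2_space :: "'a topology \<Rightarrow> bool" where
  "CT2_space X \<longleftrightarrow>
     (\<exists>\<phi>1 \<phi>2.
        continuous_map (off_diagonal X) (prod_topology (vietoris X) (vietoris X))
          (\<lambda>p. (\<phi>1 p, \<phi>2 p)) \<and>
        (\<forall>x1 \<in> topspace X. \<forall>x2 \<in> topspace X. x1 \<noteq> x2 \<longrightarrow>
           \<phi>1 (x1, x2) \<union> \<phi>2 (x1, x2) = topspace X \<and>
           x1 \<notin> \<phi>1 (x1, x2) \<and> x2 \<notin> \<phi>2 (x1, x2)))"

end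

theory Submission
  imports Defs
begin

text \<open>
  Let \<open>X\<close> be the one-point compactification of the discrete space \<open>D\<close>, with point at infinity
  \<open>None\<close>.  In every \<open>T\<^sub>1\<close>-space the map \<open>(x\<^sub>1, x\<^sub>2) \<mapsto> ({x\<^sub>2}, {x\<^sub>1})\<close> witnesses \<open>CT\<^sub>1\<close>, because
  \<open>x \<mapsto> {x}\<close> is continuous into the Vietoris topology.

  Suppose \<open>(\<phi>1, \<phi>2)\<close> witnesses \<open>CT\<^sub>2\<close>.  A closed subset of \<open>X\<close> missing \<open>None\<close> is a finite set of
  isolated points, hence open.  This applies to \<open>\<phi>2 (d, None)\<close> and to \<open>\<phi>1 (None, e)\<close>, so by
  continuity \<open>\<phi>2 (d, e) \<subseteq> \<phi>2 (d, None)\<close> for all \<open>e\<close> outside a finite set \<open>T d\<close>, and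
  \<open>\<phi>1 (d, e) \<subseteq> \<phi>1 (None, e)\<close> for all \<open>d\<close> outside a finite set \<open>S e\<close>.  As \<open>D\<close> is uncountable, there
  are distinct \<open>d\<close> and \<open>e\<close> with \<open>e \<notin> T d\<close> and \<open>d \<notin> S e\<close>; for these,
  \<open>X = \<phi>1 (d, e) \<union> \<phi>2 (d, e)\<close> would be finite.
\<close>

lemma continuous_map_singleton_vietoris:
  assumes "t1_space X"
  shows "continuous_map X (vietoris X) (\<lambda>x. {x})"
  unfolding vietoris_def
proof (rule continuous_on_generated_topo)
  have Cld: "{x} \<in> Cld X" if "x \<in> topspace X" for x
    using assms that by (simp add: Cld_def t1_space_closedin_singleton)
  show "(\<lambda>x. {x}) ` topspace X \<subseteq> \<Union>({{F \<in> Cld X. F \<inter> U \<noteq> {}} | U. openin X U} \<union>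
      {{F \<in> Cld X. F \<subseteq> U} | U. openin X U})"
    using Cld topspace_vietoris[of X]
    unfolding vietoris_def topology_generated_by_topspace by blast
  fix W
  assume "W \<in> {{F \<in> Cld X. F \<inter> U \<noteq> {}} | U. openin X U} \<union>
      {{F \<in> Cld X. F \<subseteq> U} | U. openin X U}"
  then obtain U where U: "openin X U"
    and W: "W = {F \<in> Cld X. F \<inter> U \<noteq> {}} \<or> W = {F \<in> Cld X. F \<subseteq> U}"
    by blast
  have "(\<lambda>x. {x}) -` W \<inter> topspace X = U"
    using W Cld openin_subset[OF U] by auto
  then show "openin X ((\<lambda>x. {x}) -` W \<inter> topspace X)"
    using U by simp
qed

lemma t1_imp_CT1_space:
  assumes "t1_space X"
  shows "CT1_space X"
proof -
  have "continuous_map (off_diagonal X) (vietoris X) ((\<lambda>x. {x}) \<circ> snd)"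
    "continuous_map (off_diagonal X) (vietoris X) ((\<lambda>x. {x}) \<circ> fst)"
    unfolding off_diagonal_def
    using continuous_map_singleton_vietoris[OF assms]
    by (auto intro!: continuous_map_compose continuous_map_from_subtopology
        continuous_map_fst continuous_map_snd)
  then show ?thesis
    unfolding CT1_space_def
    by (intro exI[of _ "\<lambda>p. {snd p}"] exI[of _ "\<lambda>p. {fst p}"])
      (auto simp: continuous_map_pairwise o_def)
qed

text \<open>Upper semicontinuity at \<open>(a, b)\<close>: it uses only the subbasic sets \<open>U\<^sup>+\<close>, and it is the only
  consequence of continuity needed to refute \<open>CT\<^sub>2\<close>.\<close>

lemma continuous_map_vietoris_upper:
  assumes f: "continuous_map (off_diagonal X) (vietoris X) f"
    and ab: "a \<in> topspace X" "b \<in> topspace X" "a \<noteq> b"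
    and B: "openin X B" "f (a, b) \<subseteq> B"
  shows "\<exists>U V. openin X U \<and> openin X V \<and> a \<in> U \<and> b \<in> V \<and>
    (\<forall>u\<in>U. \<forall>v\<in>V. u \<noteq> v \<longrightarrow> f (u, v) \<subseteq> B)"
proof -
  have "openin (vietoris X) {F \<in> Cld X. F \<subseteq> B}"
    unfolding vietoris_def by (rule topology_generated_by_Basis) (use B in blast)
  then have "openin (off_diagonal X)
      {p \<in> topspace (off_diagonal X). f p \<in> {F \<in> Cld X. F \<subseteq> B}}"
    using f by (rule openin_continuous_map_preimage[rotated])
  then obtain T where T: "openin (prod_topology X X) T"
    and eq: "{p \<in> topspace (off_diagonal X). f p \<in> {F \<in> Cld X. F \<subseteq> B}}
      = T \<inter> (topspace X \<times> topspace X - {(x, x) | x. x \<in> topspace X})"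
    unfolding off_diagonal_def openin_subtopology by blast
  have top: "p \<in> topspace (off_diagonal X) \<longleftrightarrow>
      fst p \<in> topspace X \<and> snd p \<in> topspace X \<and> fst p \<noteq> snd p" for p
    unfolding off_diagonal_def by (cases p) auto
  have "f (a, b) \<in> Cld X"
    using f ab top[of "(a, b)"] by (auto simp: continuous_map_def)
  then have "(a, b) \<in> {p \<in> topspace (off_diagonal X). f p \<in> {F \<in> Cld X. F \<subseteq> B}}"
    using ab B top by simp
  then have "(a, b) \<in> T"
    unfolding eq by (rule IntD1)
  then obtain U V where UV: "openin X U" "openin X V" "a \<in> U" "b \<in> V" "U \<times> V \<subseteq> T"
    using T unfolding openin_prod_topology_alt by metis
  have "f (u, v) \<subseteq> B" if "u \<in> U" "v \<in> V" "u \<noteq> v" for u v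
  proof -
    have "(u, v) \<in> T \<inter> (topspace X \<times> topspace X - {(x, x) | x. x \<in> topspace X})"
      using that UV openin_subset by fast
    then show ?thesis unfolding eq[symmetric] by blast
  qed
  with UV show ?thesis by (intro exI[of _ U] exI[of _ V]) simp
qed

lemma closedin_Alexandroff_discrete_missing_None:
  assumes "closedin (Alexandroff_compactification (discrete_topology D)) F" "None \<notin> F"
  shows "finite F" "openin (Alexandroff_compactification (discrete_topology D)) F"
  using assms by (auto simp: closedin_Alexandroff_compactification compactin_discrete_topology)

lemma openin_Alexandroff_discrete_cofinite:
  assumes "openin (Alexandroff_compactification (discrete_topology D)) V" "None \<in> V"
  shows "finite {d \<in> D. Some d \<notin> V}"
proof -
  from assms obtain C where C: "finite C" and V: "V = insert None (Some ` (D - C))"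
    by (auto simp: openin_Alexandroff_compactification compactin_discrete_topology)
  show ?thesis by (rule finite_subset[OF _ C]) (auto simp: V)
qed

text \<open>The only use of uncountability: given a countably infinite \<open>N \<subseteq> D\<close>, the union of the sets \<open>T d\<close>
  with \<open>d \<in> N\<close> is countable, so some \<open>e\<close> avoids it and \<open>N\<close>, while the finite set \<open>S e\<close> cannot contain
  all of \<open>N\<close>.\<close>

lemma uncountable_free_pair:
  assumes D: "uncountable D"
    and T: "\<And>d. d \<in> D \<Longrightarrow> finite (T d)" and S: "\<And>e. e \<in> D \<Longrightarrow> finite (S e)"
  obtains d e where "d \<in> D" "e \<in> D" "d \<noteq> e" "e \<notin> T d" "d \<notin> S e"
proof -
  have "infinite D"
    using D uncountable_infinite by blast
  then obtain N where N: "N \<subseteq> D" "infinite N" "countable N"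
    using infinite_countable_subset'[of D] by blast
  have "countable (T d)" if "d \<in> N" for d
    using T N(1) that by (blast intro: countable_finite)
  then have "countable (N \<union> (\<Union>d\<in>N. T d))"
    using N(3) by simp
  then have "\<not> D \<subseteq> N \<union> (\<Union>d\<in>N. T d)"
    using D countable_subset by blast
  then obtain e where e: "e \<in> D" "e \<notin> N" "\<And>d. d \<in> N \<Longrightarrow> e \<notin> T d"
    by blast
  obtain d where "d \<in> N" "d \<notin> S e"
    using N S[OF e(1)] by (meson finite_subset subsetI)
  with e N that show thesis by blast
qed

lemma uncountable_imp_not_CT2_Alexandroff:
  assumes D: "uncountable D"
  shows "\<not> CT2_space (Alexandroff_compactification (discrete_topology D))"
proof
  define X where "X = Alexandroff_compactification (discrete_topology D)"
  have topX: "topspace X = insert None (Some ` D)"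
    by (simp add: X_def)
  note closed_small = closedin_Alexandroff_discrete_missing_None[of D, folded X_def]
  note open_large = openin_Alexandroff_discrete_cofinite[of D, folded X_def]
  assume "CT2_space (Alexandroff_compactification (discrete_topology D))"
  then obtain \<phi>1 \<phi>2 where
    cont: "continuous_map (off_diagonal X) (vietoris X) \<phi>1"
      "continuous_map (off_diagonal X) (vietoris X) \<phi>2"
    and sep: "\<And>x y. x \<in> topspace X \<Longrightarrow> y \<in> topspace X \<Longrightarrow> x \<noteq> y \<Longrightarrow>
      \<phi>1 (x, y) \<union> \<phi>2 (x, y) = topspace X \<and> x \<notin> \<phi>1 (x, y) \<and> y \<notin> \<phi>2 (x, y)"
    unfolding CT2_space_def X_def[symmetric] by (auto simp: continuous_map_pairwise o_def)
  have closed: "closedin X (\<phi> (x, y))"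
    if "continuous_map (off_diagonal X) (vietoris X) \<phi>"
      "x \<in> topspace X" "y \<in> topspace X" "x \<noteq> y" for \<phi> x y
  proof -
    have "(x, y) \<in> topspace (off_diagonal X)"
      using that by (auto simp: off_diagonal_def)
    with that(1) show ?thesis
      by (auto simp: continuous_map_def Cld_def)
  qed
  have None: "None \<in> topspace X" and Some: "Some d \<in> topspace X" if "d \<in> D" for d
    using that by (auto simp: topX)
  have small2: "finite (\<phi>2 (Some d, None))" "openin X (\<phi>2 (Some d, None))" if "d \<in> D" for d
    using closed[OF cont(2)] sep closed_small Some[OF that] None[OF that] by auto
  have small1: "finite (\<phi>1 (None, Some e))" "openin X (\<phi>1 (None, Some e))" if "e \<in> D" for e
    using closed[OF cont(1)] sep closed_small Some[OF that] None[OF that] by auto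
  define T where "T d = {e \<in> D. e \<noteq> d \<and> \<not> \<phi>2 (Some d, Some e) \<subseteq> \<phi>2 (Some d, None)}" for d
  define S where "S e = {d \<in> D. d \<noteq> e \<and> \<not> \<phi>1 (Some d, Some e) \<subseteq> \<phi>1 (None, Some e)}" for e
  have "finite (T d)" if d: "d \<in> D" for d
  proof -
    have "\<exists>U V. openin X U \<and> openin X V \<and> Some d \<in> U \<and> None \<in> V \<and>
      (\<forall>u\<in>U. \<forall>v\<in>V. u \<noteq> v \<longrightarrow> \<phi>2 (u, v) \<subseteq> \<phi>2 (Some d, None))"
      by (rule continuous_map_vietoris_upper[OF cont(2) Some[OF d] None[OF d] _ small2(2)[OF d]])
        simp_all
    then obtain U V where UV: "openin X U" "openin X V" "Some d \<in> U" "None \<in> V"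
      "\<forall>u\<in>U. \<forall>v\<in>V. u \<noteq> v \<longrightarrow> \<phi>2 (u, v) \<subseteq> \<phi>2 (Some d, None)"
      by (elim exE conjE)
    have "\<phi>2 (Some d, Some e) \<subseteq> \<phi>2 (Some d, None)" if "Some e \<in> V" "e \<noteq> d" for e
      using UV(3,5) that by simp
    then have "T d \<subseteq> {e \<in> D. Some e \<notin> V}"
      unfolding T_def by blast
    then show ?thesis
      using open_large[OF UV(2,4)] by (rule finite_subset)
  qed
  moreover have "finite (S e)" if e: "e \<in> D" for e
  proof -
    have "\<exists>U V. openin X U \<and> openin X V \<and> None \<in> U \<and> Some e \<in> V \<and>
      (\<forall>u\<in>U. \<forall>v\<in>V. u \<noteq> v \<longrightarrow> \<phi>1 (u, v) \<subseteq> \<phi>1 (None, Some e))"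
      by (rule continuous_map_vietoris_upper[OF cont(1) None[OF e] Some[OF e] _ small1(2)[OF e]])
        simp_all
    then obtain U V where UV: "openin X U" "openin X V" "None \<in> U" "Some e \<in> V"
      "\<forall>u\<in>U. \<forall>v\<in>V. u \<noteq> v \<longrightarrow> \<phi>1 (u, v) \<subseteq> \<phi>1 (None, Some e)"
      by (elim exE conjE)
    have "\<phi>1 (Some d, Some e) \<subseteq> \<phi>1 (None, Some e)" if "Some d \<in> U" "d \<noteq> e" for d
      using UV(4,5) that by simp
    then have "S e \<subseteq> {d \<in> D. Some d \<notin> U}"
      unfolding S_def by blast
    then show ?thesis
      using open_large[OF UV(1,3)] by (rule finite_subset)
  qed
  ultimately obtain d e where de: "d \<in> D" "e \<in> D" "d \<noteq> e" "e \<notin> T d" "d \<notin> S e"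
    by (rule uncountable_free_pair[OF D])
  then have "\<phi>1 (Some d, Some e) \<union> \<phi>2 (Some d, Some e)
      \<subseteq> \<phi>1 (None, Some e) \<union> \<phi>2 (Some d, None)"
    by (auto simp: T_def S_def)
  then have "topspace X \<subseteq> \<phi>1 (None, Some e) \<union> \<phi>2 (Some d, None)"
    using sep[of "Some d" "Some e"] de Some by auto
  then have "finite (topspace X)"
    using small1(1)[OF de(2)] small2(1)[OF de(1)] finite_subset by blast
  then have "finite D"
    by (simp add: topX finite_image_iff)
  then show False
    using D countable_finite by blast
qed

theorem mainTheorem10:
  fixes D :: "'a set"
  assumes "uncountable D"
  shows "CT1_space (Alexandroff_compactification (discrete_topology D)) \<and>
    Hausdorff_space (Alexandroff_compactification (discrete_topology D)) \<and>
    compact_space (Alexandroff_compactification (discrete_topology D)) \<and>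
    \<not> CT2_space (Alexandroff_compactification (discrete_topology D))"
proof -
  have "Hausdorff_space (Alexandroff_compactification (discrete_topology D))"
    by (simp add: Hausdorff_space_Alexandroff_compactification
        locally_compact_space_discrete_topology)
  then show ?thesis
    using assms by (simp add: t1_imp_CT1_space Hausdorff_imp_t1_space
        uncountable_imp_not_CT2_Alexandroff)
qed

end
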